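(* Let $n\ge 2$ be a prime power, let $F=\{a_1,\dots,a_n\}$ be the field of order $n$ (with its elements listed in any order), and let $\alpha$ be a primitive element of $F$. For $i\neq j$ with $1\le i,j\le n$ let $M_{i,j}\in\{0,1,\dots,n-2\}$ be the discrete logarithm of $a_i-a_j$ to the base $\alpha$, i.e. $\alpha^{M_{i,j}}=a_i-a_j$. For $1\le i,j\le n+1$ define $$u^{(i)}_j=\begin{cases}0 & \text{if } i=j \text{ or } i=n+1 \text{ or } j=n+1,\\[2pt] \dfrac{M_{i,j}+\frac12}{n-1}-\dfrac12 & \text{otherwise,}\end{cases}$$ and $u^{(i)}=(u^{(i)}_1,\dots,u^{(i)}_{n+1})$. Then $u^{(i)}\in H_n$ and $u^{(i)}_i=0$ for every $i$, and the families of parallel lines $$L_i=u^{(i)}+A_n+\{t v^{(i)} : t\in\mathbb{R}\},\qquad 1\le i\le n+1,$$ have the following properties. (1) For each $i$, the projection of $L_i$ along $v^{(i)}$ to the hyperplane $\{x\in H_n : x_i=0\}$ of $H_n$ perpendicular to $v^{(i)}$ is a translate of the projection of $A_n^*$ along $v^{(i)}$ to the same hyperplane. (2) For all $i\ne j$ in $\{1,\dots,n+1\}$, the $n-1$ coordinates of $u^{(i)}-u^{(j)}$ other than the $i$th and the $j$th are uniformly distributed modulo 1, and the minimal distance between a line in $L_i$ and a line in $L_j$ equals $\sqrt{\frac{n(n-2)}{12(n-1)}}$, which is the largest value this minimal distance can take over all choices of vectors $u^{(i)},u^{(j)}\in H_n$ with $u^{(i)}_i=0$ and $u^{(j)}_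j=0$.
   Context: $H_n=\{x\in\mathbb{R}^{n+1} : \sum_{k} x_k=0\}$ with the Euclidean metric of $\mathbb{R}^{n+1}$. $A_n=\mathbb{Z}^{n+1}\cap H_n$. $A_n^*$ is the permutohedral lattice, consisting of all $x\in H_n$ with $x_k-x_l\in\mathbb{Z}$ for all $k,l\in\{1,\dots,n+1\}$. For $1\le i\le n+1$, $v^{(i)}\in H_n$ is the vector whose $i$th coordinate is $\frac{n}{n+1}$ and whose other coordinates are all $-\frac1{n+1}$. The set $L_i$ is regarded as a collection of lines parallel to $v^{(i)}$, namely the lines $u^{(i)}+a+\{t v^{(i)}: t\in\mathbb{R}\}$ with $a\in A_n$; "the minimal distance between a line in $L_i$ and a line in $L_j$" is the minimum of the Euclidean distance between a line of the first collection and a line of the second, over all such pairs. Real numbers $y_1,\dots,y_m$ are uniformly distributed modulo 1 if there is a real $c$ such that, up to reordering, $y_1,\dots,y_m$ are congruent modulo 1 to $c,\ c+\frac1m,\ \dots,\ c+\frac{m-1}{m}$. *)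

theory Defs
  imports
    "HOL-Analysis.Analysis"
    "HOL-Library.Real_Mod"
    "HOL-Number_Theory.Prime_Powers"
begin

(* The coordinates 1, ..., n+1 are the elements of a finite index type 'k, so n + 1 = CARD('k). *)

definition hyperplane_H :: "(real ^ 'k) set" where
  "hyperplane_H = {x. (\<Sum>k\<in>UNIV. x $ k) = 0}"

definition lattice_A :: "(real ^ 'k) set" where
  "lattice_A = {x \<in> hyperplane_H. \<forall>k. x $ k \<in> \<int>}"

definition lattice_A_dual :: "(real ^ 'k) set" where
  "lattice_A_dual = {x \<in> hyperplane_H. \<forall>k l. x $ k - x $ l \<in> \<int>}"

definition vec_v :: "'k \<Rightarrow> real ^ 'k" where
  "vec_v i = (\<chi> k. if k = i then (real CARD('k) - 1) / real CARD('k) else - 1 / real CARD('k))"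

definition perp_hyperplane :: "'k \<Rightarrow> (real ^ 'k) set" where
  "perp_hyperplane i = {x \<in> hyperplane_H. x $ i = 0}"

lemma perp_hyperplane_altdef:
  fixes i :: "'k::finite"
  shows "perp_hyperplane i = {x \<in> hyperplane_H. x \<bullet> vec_v i = 0}"
proof -
  have "x \<bullet> vec_v i = x $ i" if "x \<in> hyperplane_H" for x :: "real ^ 'k"
  proof -
    have "vec_v i = axis i 1 - (1 / real CARD('k)) *\<^sub>R (1 :: real ^ 'k)"
      by (simp add: vec_eq_iff vec_v_def axis_def field_simps)
    moreover have "x \<bullet> 1 = 0"
      using that by (simp add: hyperplane_H_def inner_vec_def)
    ultimately show ?thesis
      by (simp add: inner_diff_right inner_axis)
  qed
  thus ?thesis by (auto simp: perp_hyperplane_def)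
qed

definition line_through :: "real ^ 'k \<Rightarrow> real ^ 'k \<Rightarrow> (real ^ 'k) set" where
  "line_through p v = {p + t *\<^sub>R v | t. True}"

definition line_family :: "real ^ 'k \<Rightarrow> 'k \<Rightarrow> (real ^ 'k) set set" where
  "line_family w i = {line_through (w + a) (vec_v i) | a. a \<in> lattice_A}"

(* For S inside hyperplane_H, every point of S is moved along vec_v i to the unique point of
   perp_hyperplane i on the same parallel of vec_v i. *)
definition project_along :: "'k \<Rightarrow> (real ^ 'k) set \<Rightarrow> (real ^ 'k) set" where
  "project_along i S = {y \<in> perp_hyperplane i. \<exists>x\<in>S. \<exists>t. y = x + t *\<^sub>R vec_v i}"

definition is_translate :: "(real ^ 'k) set \<Rightarrow> (real ^ 'k) set \<Rightarrow> bool" where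
  "is_translate S T \<longleftrightarrow> (\<exists>w. S = (+) w ` T)"

definition unif_mod_1 :: "('k \<Rightarrow> real) \<Rightarrow> 'k set \<Rightarrow> bool" where
  "unif_mod_1 y K \<longleftrightarrow>
    (\<exists>c \<sigma>. bij_betw \<sigma> K {0..<card K} \<and>
      (\<forall>k\<in>K. [y k = c + real (\<sigma> k) / real (card K)] (rmod 1)))"

(* d is the minimum, which in particular exists, of the distances between members of P and Q. *)
definition is_min_dist :: "(real ^ 'k) set set \<Rightarrow> (real ^ 'k) set set \<Rightarrow> real \<Rightarrow> bool" where
  "is_min_dist P Q d \<longleftrightarrow>
    (\<exists>l\<in>P. \<exists>m\<in>Q. setdist l m = d) \<and> (\<forall>l\<in>P. \<forall>m\<in>Q. d \<le> setdist l m)"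

definition primitive_element :: "'f :: field \<Rightarrow> bool" where
  "primitive_element \<alpha> \<longleftrightarrow> range (\<lambda>k::nat. \<alpha> ^ k) = - {0}"

end

theory Submission
  imports Defs
begin

text \<open>
  Let \<open>S\<close> be the set of the \<open>m = n - 1\<close> coordinates other than the \<open>i\<close>-th and the \<open>j\<close>-th.
  The distance of two lines \<open>p + \<real> v\<^sup>(\<^sup>i\<^sup>)\<close> and \<open>q + \<real> v\<^sup>(\<^sup>j\<^sup>)\<close> is the Euclidean distance from the
  restriction of \<open>p - q\<close> to \<open>S\<close> to the constant vectors.  As \<open>a\<close> ranges over \<open>A\<^sub>n\<close>, its
  restriction to \<open>S\<close> ranges over all integer vectors, so the minimal distance only depends on
  the \<open>m\<close> points \<open>y\<^sub>k = w\<^sub>k - w'\<^sub>k\<close> on the circle \<open>\<real>/\<int>\<close>: each way of cutting the circle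
  open between two of them gives a candidate, whose squared distance is \<open>1/m\<close> times the sum of
  the squares of the pairwise differences.  Averaging over the cuts, weighted by the gap lengths,
  bounds the minimum by \<open>1/m\<close> times the sum of \<open>d (1 - d)\<close> over all pairs, a concave function
  of the points that is maximal, with value \<open>(m\<^sup>2 - 1) / (12 m)\<close>, at equally spaced points.
  Conversely, if the points are equally spaced, then \<open>m (y\<^sub>k + b\<^sub>k)\<close> are, up to a common
  translation, distinct integers, and \<open>m\<close> distinct integers are least spread out when they
  are consecutive.

  The vectors \<open>u\<^sup>(\<^sup>i\<^sup>)\<close> produce equally spaced points because the quotients
  \<open>(a\<^sub>i - a\<^sub>k) / (a\<^sub>j - a\<^sub>k)\<close> are pairwise distinct and different from \<open>1\<close>; the
  coordinate \<open>n + 1\<close> supplies the missing residue \<open>0\<close>.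
\<close>

section \<open>Square deviation from the mean\<close>

text \<open>The squared Euclidean distance from \<open>y\<close> restricted to \<open>S\<close> to
  the line of constant vectors, whose nearest point is the mean.\<close>

definition sq_dev :: "'a set \<Rightarrow> ('a \<Rightarrow> real) \<Rightarrow> real" where
  "sq_dev S y = (\<Sum>k\<in>S. (y k - (\<Sum>l\<in>S. y l) / real (card S))\<^sup>2)"

text \<open>Pythagoras (the parallel axis theorem): deviations from the mean sum to zero, so the
  cross term vanishes.\<close>

lemma sum_sq_diff_eq_sq_dev:
  assumes "finite S" "S \<noteq> {}"
  shows "(\<Sum>k\<in>S. (y k - c)\<^sup>2) = sq_dev S y + real (card S) * ((\<Sum>l\<in>S. y l) / real (card S) - c)\<^sup>2"
proof -
  have m: "real (card S) > 0" using assms by (simp add: card_gt_0_iff)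
  define \<mu> where "\<mu> = (\<Sum>l\<in>S. y l) / real (card S)"
  have sum: "(\<Sum>l\<in>S. y l) = real (card S) * \<mu>" using m by (simp add: \<mu>_def)
  have "(\<Sum>k\<in>S. (y k - c)\<^sup>2) = (\<Sum>k\<in>S. (y k - \<mu>)\<^sup>2 + 2 * (\<mu> - c) * (y k - \<mu>) + (\<mu> - c)\<^sup>2)"
    by (intro sum.cong refl) (simp add: power2_eq_square algebra_simps)
  also have "\<dots> = (\<Sum>k\<in>S. (y k - \<mu>)\<^sup>2) + 2 * (\<mu> - c) * (\<Sum>k\<in>S. y k - \<mu>) + real (card S) * (\<mu> - c)\<^sup>2"
    by (simp add: sum.distrib sum_distrib_left)
  also have "(\<Sum>k\<in>S. y k - \<mu>) = 0" by (simp add: sum_subtractf sum)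
  finally show ?thesis by (simp add: sq_dev_def \<mu>_def)
qed

lemma sq_dev_le_sum_sq_diff:
  assumes "finite S"
  shows "sq_dev S y \<le> (\<Sum>k\<in>S. (y k - c)\<^sup>2)"
proof (cases "S = {}")
  case False
  then show ?thesis using sum_sq_diff_eq_sq_dev[OF assms, of y c] by simp
qed (simp add: sq_dev_def)

text \<open>Taking each \<open>y l\<close> as the centre \<open>c\<close> in the previous identity
  removes the mean; later estimates work with pairwise differences only.\<close>

lemma sum_sum_sq_diff_eq_sq_dev:
  assumes "finite S" "S \<noteq> {}"
  shows "(\<Sum>k\<in>S. \<Sum>l\<in>S. (y k - y l)\<^sup>2) = 2 * real (card S) * sq_dev S y"
proof -
  have "(\<Sum>k\<in>S. \<Sum>l\<in>S. (y k - y l)\<^sup>2) = (\<Sum>l\<in>S. \<Sum>k\<in>S. (y k - y l)\<^sup>2)"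
    by (rule sum.swap)
  also have "\<dots> = real (card S) * sq_dev S y
      + real (card S) * (\<Sum>l\<in>S. ((\<Sum>l\<in>S. y l) / real (card S) - y l)\<^sup>2)"
    by (simp add: sum_sq_diff_eq_sq_dev[OF assms] sum.distrib sum_distrib_left)
  also have "(\<Sum>l\<in>S. ((\<Sum>l\<in>S. y l) / real (card S) - y l)\<^sup>2) = sq_dev S y"
    unfolding sq_dev_def by (intro sum.cong refl) (simp add: power2_commute)
  finally show ?thesis by simp
qed

lemma sq_dev_cong:
  assumes "\<And>k. k \<in> S \<Longrightarrow> y k = y' k"
  shows "sq_dev S y = sq_dev S y'"
proof -
  have "sum y S = sum y' S" using assms by (intro sum.cong) auto
  then show ?thesis using assms unfolding sq_dev_def by (intro sum.cong) auto
qed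

lemma sq_dev_reindex:
  assumes "bij_betw p T S"
  shows "sq_dev S y = sq_dev T (y \<circ> p)"
proof -
  have "sum f S = sum (f \<circ> p) T" for f :: "_ \<Rightarrow> real"
    using sum.reindex_bij_betw[OF assms, of f] by simp
  with bij_betw_same_card[OF assms] show ?thesis
    by (simp add: sq_dev_def)
qed

section \<open>Integer translates of minimal deviation\<close>

text \<open>There are infinitely many shifts, so the order of minimisation is exchanged: for a fixed
  centre \<open>c\<close> the best shift rounds each coordinate separately, and the remaining
  function of \<open>c\<close> is continuous with period 1.\<close>

lemma sq_dev_int_shift_attains_min:
  fixes y :: "'a \<Rightarrow> real"
  assumes "finite S"
  shows "\<exists>b::'a \<Rightarrow> int. \<forall>b'::'a \<Rightarrow> int. sq_dev S (\<lambda>k. y k + b k) \<le> sq_dev S (\<lambda>k. y k + b' k)"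
proof -
  \<comment> \<open>\<open>f c\<close> is the least value of the sum of
    \<open>(y k + b k - c)\<^sup>2\<close> over all integer shifts \<open>b\<close>.\<close>
  define f where "f c = (\<Sum>k\<in>S. (infdist (c - y k) \<int>)\<^sup>2)" for c
  have cont: "continuous_on {0..1} f"
    unfolding f_def by (intro continuous_intros)
  obtain c where c: "c \<in> {0..1}" "\<And>c'. c' \<in> {0..1} \<Longrightarrow> f c \<le> f c'"
    using continuous_attains_inf[OF compact_Icc _ cont] by auto
  have "\<exists>b::int. infdist (c - y k) \<int> = \<bar>c - y k - b\<bar>" for k
  proof -
    have "(\<int> :: real set) \<noteq> {}" by (metis Ints_0 empty_iff)
    with infdist_attains_inf[of \<int> "c - y k"] obtain x :: real
      where "x \<in> \<int>" "infdist (c - y k) \<int> = dist (c - y k) x" by auto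
    then show ?thesis by (auto simp: dist_real_def elim!: Ints_cases)
  qed
  then obtain b :: "'a \<Rightarrow> int" where b: "\<And>k. infdist (c - y k) \<int> = \<bar>c - y k - b k\<bar>"
    by metis
  have "sq_dev S (\<lambda>k. y k + b k) \<le> sq_dev S (\<lambda>k. y k + b' k)" for b' :: "'a \<Rightarrow> int"
  proof -
    define \<mu> where "\<mu> = (\<Sum>l\<in>S. y l + b' l) / real (card S)"
    have "sq_dev S (\<lambda>k. y k + b k) \<le> (\<Sum>k\<in>S. (y k + b k - c)\<^sup>2)"
      using assms by (rule sq_dev_le_sum_sq_diff)
    also have "\<dots> = f c" unfolding f_def b
      by (intro sum.cong refl) (simp add: power2_eq_square algebra_simps)
    \<comment> \<open>The mean is moved into the unit interval; the integer part
      \<open>\<lfloor>\<mu>\<rfloor>\<close> is then absorbed into the shift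
      \<open>b'\<close>.\<close>
    also have "\<dots> \<le> f (frac \<mu>)" using c(2)[of "frac \<mu>"] frac_lt_1[of \<mu>] by simp
    also have "\<dots> \<le> (\<Sum>k\<in>S. (y k + b' k - \<mu>)\<^sup>2)" unfolding f_def
    proof (intro sum_mono)
      fix k
      have "infdist (frac \<mu> - y k) \<int> \<le> dist (frac \<mu> - y k) (of_int (b' k - \<lfloor>\<mu>\<rfloor>))"
        by (intro infdist_le) auto
      also have "\<dots> = \<bar>y k + b' k - \<mu>\<bar>" by (simp add: dist_real_def frac_def)
      finally show "(infdist (frac \<mu> - y k) \<int>)\<^sup>2 \<le> (y k + b' k - \<mu>)\<^sup>2"
        using infdist_nonneg by (subst power2_abs[symmetric], subst (2) power2_abs[symmetric]) (intro power_mono, auto)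
    qed
    also have "\<dots> = sq_dev S (\<lambda>k. y k + b' k)" by (simp add: sq_dev_def \<mu>_def)
    finally show ?thesis .
  qed
  then show ?thesis by blast
qed

section \<open>Upper bound: averaging over the cuts of the circle\<close>

lemma sum_sum_sq_diff_lessThan:
  "(\<Sum>k<m. \<Sum>l<m. (real k - real l)\<^sup>2) = (real m)\<^sup>2 * ((real m)\<^sup>2 - 1) / 6"
proof (induction m)
  case (Suc m)
  have sq: "(\<Sum>k<m. (x - real k)\<^sup>2) = real m * x\<^sup>2 - x * real m * (real m - 1) + real m * (real m - 1) * (2 * real m - 1) / 6" for x
    by (induction m) (simp_all add: field_simps power2_eq_square)
  define T where "T = (\<Sum>k<m. (real m - real k)\<^sup>2)"
  have "T = (\<Sum>k<m. (real k - real m)\<^sup>2)"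
    unfolding T_def by (intro sum.cong refl power2_commute)
  then have "(\<Sum>k<Suc m. \<Sum>l<Suc m. (real k - real l)\<^sup>2)
      = (real m)\<^sup>2 * ((real m)\<^sup>2 - 1) / 6 + 2 * T"
    using Suc by (simp add: sum.distrib flip: T_def)
  then show ?case
    unfolding T_def sq by (simp add: field_simps power2_eq_square)
qed simp

text \<open>\<open>g\<close> lists the gaps between cyclically consecutive points of \<open>r\<close> on the circle; the cut
  made in the \<open>s\<close>-th gap moves the \<open>s\<close> smallest points up by one.  Weighting each cut by
  its gap, the averaged squared distance of two points at distance \<open>d\<close> is
  \<open>d * (1 - d)\<^sup>2 + (1 - d) * d\<^sup>2 = d - d\<^sup>2\<close>.\<close>
lemma ex_cut_sq_dev_le:
  fixes r :: "nat \<Rightarrow> real"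
  assumes m: "m > 0" and mono: "\<And>k l. k \<le> l \<Longrightarrow> l < m \<Longrightarrow> r k \<le> r l" and len: "r (m - 1) \<le> r 0 + 1"
  shows "\<exists>s<m. sq_dev {..<m} (\<lambda>k. r k + of_bool (k < s)) \<le> ((real m)\<^sup>2 - 1) / (12 * real m)"
proof -
  \<comment> \<open>The gap with index 0 is the one that wraps around from the last point to the
    first.\<close>
  define g where "g s = (if s = 0 then 1 - (r (m - 1) - r 0) else r s - r (s - 1))" for s
  define W where "W s = (\<Sum>k<m. \<Sum>l<m. (r k + of_bool (k < s) - (r l + of_bool (l < s)))\<^sup>2)" for s
  have g0: "g s \<ge> 0" if "s < m" for s
    using len mono[of "s - 1" s] that by (auto simp: g_def)
  have tele: "(\<Sum>s\<in>{k<..l}. g s) = r l - r k" if "k \<le> l" for k l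
    using that
  proof (induction l rule: dec_induct)
    case (step l)
    then have "{k<..Suc l} = insert (Suc l) {k<..l}" by auto
    with step show ?case by (simp add: g_def)
  qed simp
  have g1: "(\<Sum>s<m. g s) = 1"
  proof -
    have "{..<m} = insert 0 {0<..m-1}" using m by auto
    then have "(\<Sum>s<m. g s) = g 0 + (\<Sum>s\<in>{0<..m-1}. g s)" by simp
    then show ?thesis using tele[of 0 "m - 1"] by (simp add: g_def)
  qed
  have pair: "(\<Sum>s<m. g s * (r k + of_bool (k < s) - (r l + of_bool (l < s)))\<^sup>2)
      = (r l - r k) - (r l - r k)\<^sup>2" if "k \<le> l" "l < m" for k l
  proof -
    define d where "d = r l - r k"
    \<comment> \<open>Only the cuts with \<open>k < s\<close> and \<open>s \<le> l\<close> separate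
      the two points; they turn the distance \<open>d\<close> into \<open>1 - d\<close>, and
      \<open>(1 - d)\<^sup>2 = d\<^sup>2 + (1 - 2 * d)\<close>.\<close>
    have "(\<Sum>s<m. g s * (r k + of_bool (k < s) - (r l + of_bool (l < s)))\<^sup>2)
        = (\<Sum>s<m. g s * d\<^sup>2 + (if s \<in> {k<..l} then g s * (1 - 2 * d) else 0))"
      using that by (intro sum.cong refl) (auto simp: d_def power2_eq_square algebra_simps)
    also have "\<dots> = d\<^sup>2 + (\<Sum>s\<in>{..<m} \<inter> {k<..l}. g s * (1 - 2 * d))"
      by (subst sum.inter_restrict) (simp_all add: sum.distrib g1 flip: sum_distrib_right)
    also have "{..<m} \<inter> {k<..l} = {k<..l}" using that by auto
    also have "d\<^sup>2 + (\<Sum>s\<in>{k<..l}. g s * (1 - 2 * d)) = d - d\<^sup>2"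
      unfolding sum_distrib_right[symmetric] tele[OF that(1)] d_def[symmetric]
      by (simp add: power2_eq_square algebra_simps)
    finally show ?thesis by (simp add: d_def)
  qed
  \<comment> \<open>As \<open>r\<close> is monotone, \<open>sg k l * (r k - r l)\<close> is the
    absolute difference of the two points, written linearly in \<open>r\<close>.\<close>
  define sg where "sg k l = sgn (real k - real l)" for k l :: nat
  have pair': "(\<Sum>s<m. g s * (r k + of_bool (k < s) - (r l + of_bool (l < s)))\<^sup>2)
      = sg k l * (r k - r l) - (r k - r l)\<^sup>2" if "k < m" "l < m" for k l
  proof (cases "k \<le> l")
    case True
    then show ?thesis using pair[of k l] that
      by (cases "k = l") (auto simp: sg_def sgn_if power2_commute)
  next
    case False
    have "(\<Sum>s<m. g s * (r k + of_bool (k < s) - (r l + of_bool (l < s)))\<^sup>2)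
       = (\<Sum>s<m. g s * (r l + of_bool (l < s) - (r k + of_bool (k < s)))\<^sup>2)"
      by (intro sum.cong refl) (simp add: power2_commute)
    then show ?thesis using pair[of l k] that False by (auto simp: sg_def sgn_if)
  qed
  \<comment> \<open>Coefficients of the tangent to the concave function at the equally spaced points
    \<open>real k / real m\<close>. This is the maximum, so the tangent has no linear part:
    \<open>h\<close> is antisymmetric with zero row sums.\<close>
  define h where "h k l = sg k l - 2 * (real k - real l) / real m" for k l
  have h_antisym: "h l k = - h k l" for k l
    by (auto simp: h_def sg_def sgn_if diff_divide_distrib algebra_simps)
  have h_sum: "(\<Sum>l<m. h k l) = 0" if "k < m" for k
  proof -
    have eq: "{..<m} = {..<k} \<union> ({k} \<union> {k<..<m})" using that by auto
    have "(\<Sum>l<m. sg k l) = (\<Sum>l<k. sg k l) + (sg k k + (\<Sum>l\<in>{k<..<m}. sg k l))"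
      unfolding eq by (subst sum.union_disjoint; (subst sum.union_disjoint)?) auto
    also have "(\<Sum>l<k. sg k l) = (\<Sum>l<k. 1)" by (intro sum.cong refl) (auto simp: sg_def)
    also have "(\<Sum>l\<in>{k<..<m}. sg k l) = (\<Sum>l\<in>{k<..<m}. -1)"
      by (intro sum.cong refl) (auto simp: sg_def)
    finally have 1: "(\<Sum>l<m. sg k l) = 2 * real k + 1 - real m"
      using that by (simp add: sg_def of_nat_diff)
    have gauss: "(\<Sum>l<m. real l) = real m * (real m - 1) / 2"
      by (induction m) (simp_all add: field_simps)
    have 2: "(\<Sum>l<m. real k - real l) = real m * (real k - (real m - 1) / 2)"
      by (simp add: sum_subtractf gauss field_simps)
    have "(\<Sum>l<m. h k l) = (\<Sum>l<m. sg k l) - (\<Sum>l<m. 2 * (real k - real l) / real m)"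
      unfolding h_def by (rule sum_subtractf)
    also have "(\<Sum>l<m. 2 * (real k - real l) / real m) = 2 * (\<Sum>l<m. real k - real l) / real m"
      by (simp only: sum_distrib_left sum_divide_distrib)
    finally have "(\<Sum>l<m. h k l) = (\<Sum>l<m. sg k l) - 2 * (\<Sum>l<m. real k - real l) / real m" .
    then show ?thesis using m unfolding 1 2 by (simp add: field_simps)
  qed
  have lin: "(\<Sum>k<m. \<Sum>l<m. h k l * (r k - r l)) = 0"
  proof -
    have "h k l * (r k - r l) = r k * h k l + h l k * r l" for k l
      using h_antisym[of k l] by (simp add: algebra_simps)
    then have "(\<Sum>k<m. \<Sum>l<m. h k l * (r k - r l))
        = (\<Sum>k<m. r k * (\<Sum>l<m. h k l)) + (\<Sum>k<m. \<Sum>l<m. h l k * r l)"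
      by (simp only: sum.distrib sum_distrib_left)
    also have "(\<Sum>k<m. \<Sum>l<m. h l k * r l) = (\<Sum>l<m. r l * (\<Sum>k<m. h l k))"
      by (subst sum.swap) (simp only: sum_distrib_left mult.commute)
    finally show ?thesis by (simp add: h_sum)
  qed
  have "(\<Sum>s<m. g s * W s) = (\<Sum>s<m. \<Sum>k<m. \<Sum>l<m. g s * (r k + of_bool (k < s) - (r l + of_bool (l < s)))\<^sup>2)"
    by (simp add: W_def sum_distrib_left)
  also have "\<dots> = (\<Sum>k<m. \<Sum>l<m. \<Sum>s<m. g s * (r k + of_bool (k < s) - (r l + of_bool (l < s)))\<^sup>2)"
    by (rule trans[OF sum.swap], rule sum.cong[OF refl], rule sum.swap)
  also have "\<dots> = (\<Sum>k<m. \<Sum>l<m. sg k l * (r k - r l) - (r k - r l)\<^sup>2)"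
    by (intro sum.cong refl) (simp add: pair')
  also have "\<dots> \<le> (\<Sum>k<m. \<Sum>l<m. h k l * (r k - r l) + ((real k - real l) / real m)\<^sup>2)"
  proof (intro sum_mono)
    fix k l
    define t where "t = (real k - real l) / real m"
    \<comment> \<open>The tangent inequality, with \<open>t\<close> the difference of the two points
      in the equally spaced configuration.\<close>
    have "0 \<le> ((r k - r l) - t)\<^sup>2" by simp
    then show "sg k l * (r k - r l) - (r k - r l)\<^sup>2
        \<le> h k l * (r k - r l) + ((real k - real l) / real m)\<^sup>2"
      unfolding h_def times_divide_eq_right[symmetric] t_def[symmetric]
      by (simp add: power2_eq_square algebra_simps)
  qed
  also have "\<dots> = (\<Sum>k<m. \<Sum>l<m. (real k - real l)\<^sup>2) / (real m)\<^sup>2"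
    by (simp add: sum.distrib lin power_divide sum_divide_distrib)
  also have "\<dots> = ((real m)\<^sup>2 - 1) / 6"
    using m by (simp add: sum_sum_sq_diff_lessThan)
  finally have avg: "(\<Sum>s<m. g s * W s) \<le> ((real m)\<^sup>2 - 1) / 6" .
  obtain s where s: "s < m" "\<And>s'. s' < m \<Longrightarrow> W s \<le> W s'"
    using ex_min_if_finite[of "W ` {..<m}"] m by (auto simp: not_less)
  \<comment> \<open>The gaps are nonnegative weights of total 1, so the best cut is no worse than
    the average.\<close>
  have "W s = (\<Sum>s'<m. g s' * W s)" by (simp add: g1 flip: sum_distrib_right)
  also have "\<dots> \<le> (\<Sum>s'<m. g s' * W s')" by (intro sum_mono mult_left_mono s g0) auto
  also note avg
  also have "W s = 2 * real m * sq_dev {..<m} (\<lambda>k. r k + of_bool (k < s))"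
    unfolding W_def using m by (subst sum_sum_sq_diff_eq_sq_dev) auto
  finally show ?thesis using s(1) m by (intro exI[of _ s]) (auto simp: field_simps)
qed

text \<open>The fractional parts, once sorted, lie within one turn of the circle, so the bound for
  cuts applies to them.\<close>

lemma ex_int_shift_sq_dev_le:
  fixes y :: "'a \<Rightarrow> real"
  assumes "finite S" "S \<noteq> {}"
  shows "\<exists>b::'a \<Rightarrow> int. sq_dev S (\<lambda>k. y k + b k) \<le> ((real (card S))\<^sup>2 - 1) / (12 * real (card S))"
proof -
  obtain xs0 where xs0: "set xs0 = S" "distinct xs0" using finite_distinct_list[OF assms(1)] by blast
  define xs where "xs = sort_key (\<lambda>k. frac (y k)) xs0"
  define m where "m = card S"
  have xs: "set xs = S" "distinct xs" "sorted (map (\<lambda>k. frac (y k)) xs)" "length xs = m"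
    using xs0 distinct_card[OF xs0(2)] by (auto simp: xs_def m_def)
  have m: "m > 0" using assms by (simp add: m_def card_gt_0_iff)
  have bij: "bij_betw ((!) xs) {..<m} S"
    using bij_betw_nth[OF xs(2), of "{..<m}" S] xs by auto
  define r where "r k = frac (y (xs ! k))" for k
  have "\<exists>s<m. sq_dev {..<m} (\<lambda>k. r k + of_bool (k < s)) \<le> ((real m)\<^sup>2 - 1) / (12 * real m)"
  proof (intro ex_cut_sq_dev_le m)
    show "r k \<le> r l" if "k \<le> l" "l < m" for k l
      using sorted_nth_mono[OF xs(3), of k l] that xs(4) by (simp add: r_def)
    show "r (m - 1) \<le> r 0 + 1"
      using frac_lt_1[of "y (xs ! (m - 1))"] frac_ge_0[of "y (xs ! 0)"] unfolding r_def by linarith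
  qed
  then obtain s where s: "sq_dev {..<m} (\<lambda>k. r k + of_bool (k < s)) \<le> ((real m)\<^sup>2 - 1) / (12 * real m)"
    by blast
  \<comment> \<open>The shift passes to the fractional part and then lifts the points before the cut
    by one.\<close>
  define b :: "'a \<Rightarrow> int" where
    "b x = of_bool (the_inv_into {..<m} ((!) xs) x < s) - \<lfloor>y x\<rfloor>" for x
  have "sq_dev S (\<lambda>k. y k + b k) = sq_dev {..<m} (\<lambda>k. r k + of_bool (k < s))"
    unfolding sq_dev_reindex[OF bij]
    using bij_betw_imp_inj_on[OF bij]
    by (intro sq_dev_cong) (auto simp: r_def b_def frac_def the_inv_into_f_f)
  then show ?thesis using s unfolding m_def by metis
qed

section \<open>Lower bound: distinct integers are least spread out when consecutive\<close>

lemma sum_squares_card_le: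
  fixes A :: "int set"
  assumes "finite A" "\<And>k. k \<in> A \<Longrightarrow> k \<ge> 1"
  shows "real (card A) * (real (card A) + 1) * (2 * real (card A) + 1) / 6 \<le> (\<Sum>k\<in>A. (real_of_int k)\<^sup>2)"
  using assms
proof (induction A rule: finite_linorder_max_induct)
  case (insert M A)
  \<comment> \<open>The maximum of a set of positive integers is at least the size of the
    set.\<close>
  have "A \<subseteq> {1..<M}" using insert by force
  then have "card A \<le> card {1..<M}" by (intro card_mono) auto
  then have le: "real (card A) + 1 \<le> real_of_int M" using insert.prems[of M] by simp
  have "(real (card A) + 1)\<^sup>2 \<le> (real_of_int M)\<^sup>2" using le by (intro power_mono) auto
  moreover have "M \<notin> A" using insert by auto
  ultimately show ?case using insert by (simp add: field_simps power2_eq_square)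
qed simp

text \<open>Adding a new maximum \<open>M\<close> adds its squared distances to the old elements
  twice, and these distances are distinct positive integers.\<close>

lemma sum_sum_sq_diff_int_ge:
  fixes A :: "int set"
  assumes "finite A"
  shows "(real (card A))\<^sup>2 * ((real (card A))\<^sup>2 - 1) / 6
    \<le> (\<Sum>k\<in>A. \<Sum>l\<in>A. (real_of_int k - real_of_int l)\<^sup>2)"
  using assms
proof (induction A rule: finite_linorder_max_induct)
  case (insert M A)
  have nM: "M \<notin> A" using insert by auto
  define T where "T = (\<Sum>k\<in>A. (real_of_int M - real_of_int k)\<^sup>2)"
  have inj: "inj_on (\<lambda>k. M - k) A" by (auto simp: inj_on_def)
  have "real (card A) * (real (card A) + 1) * (2 * real (card A) + 1) / 6 \<le> T"
    using sum_squares_card_le[of "(\<lambda>k. M - k) ` A"] insert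
    by (force simp: sum.reindex[OF inj] card_image[OF inj] T_def)
  moreover have "T = (\<Sum>k\<in>A. (real_of_int k - real_of_int M)\<^sup>2)"
    unfolding T_def by (intro sum.cong refl power2_commute)
  then have "(\<Sum>k\<in>insert M A. \<Sum>l\<in>insert M A. (real_of_int k - real_of_int l)\<^sup>2)
      = 2 * T + (\<Sum>k\<in>A. \<Sum>l\<in>A. (real_of_int k - real_of_int l)\<^sup>2)"
    using nM insert by (simp add: sum.distrib flip: T_def)
  ultimately show ?case using insert nM by (simp add: field_simps power2_eq_square)
qed simp

lemma sq_dev_int_shift_ge:
  fixes y :: "'a \<Rightarrow> real" and b :: "'a \<Rightarrow> int"
  assumes "finite S" "S \<noteq> {}" "unif_mod_1 y S"
  shows "((real (card S))\<^sup>2 - 1) / (12 * real (card S)) \<le> sq_dev S (\<lambda>k. y k + b k)"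
proof -
  define m where "m = card S"
  have m: "m > 0" using assms by (simp add: m_def card_gt_0_iff)
  obtain c \<sigma> where \<sigma>: "bij_betw \<sigma> S {0..<m}" and "\<forall>k\<in>S. [y k = c + real (\<sigma> k) / real m] (rmod 1)"
    using assms(3) unfolding unif_mod_1_def m_def by blast
  then have "\<forall>k\<in>S. \<exists>q::int. c + real (\<sigma> k) / real m = y k + q"
    unfolding rcong_altdef by simp
  then obtain q :: "'a \<Rightarrow> int" where q: "\<And>k. k \<in> S \<Longrightarrow> c + real (\<sigma> k) / real m = y k + q k"
    by metis
  \<comment> \<open>Rescaled by \<open>m\<close>, the shifted points are integers up to a common
    translation. They are distinct because \<open>h k\<close> modulo \<open>m\<close> returns
    \<open>\<sigma> k\<close>.\<close>
  define h where "h k = int (\<sigma> k) + int m * (b k - q k)" for k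
  have h: "y k + b k = c + h k / real m" if "k \<in> S" for k
    using q[OF that] m by (simp add: h_def field_simps)
  have "inj_on h S"
  proof (rule inj_onI)
    fix k l assume kl: "k \<in> S" "l \<in> S" "h k = h l"
    have "int (\<sigma> x) = h x mod int m" if "x \<in> S" for x
      using bij_betwE[OF \<sigma>] that by (simp add: h_def)
    with kl have "\<sigma> k = \<sigma> l" by (metis of_nat_eq_iff)
    then show "k = l" using bij_betw_imp_inj_on[OF \<sigma>] kl by (auto dest: inj_onD)
  qed
  then have "(\<Sum>k\<in>S. \<Sum>l\<in>S. (real_of_int (h k) - real_of_int (h l))\<^sup>2) \<ge> (real m)\<^sup>2 * ((real m)\<^sup>2 - 1) / 6"
    using sum_sum_sq_diff_int_ge[of "h ` S"] assms(1) by (simp add: sum.reindex card_image m_def)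
  also have "(\<Sum>k\<in>S. \<Sum>l\<in>S. (real_of_int (h k) - real_of_int (h l))\<^sup>2)
     = (\<Sum>k\<in>S. \<Sum>l\<in>S. (real m)\<^sup>2 * ((y k + b k) - (y l + b l))\<^sup>2)"
    using m by (intro sum.cong refl) (simp add: h field_simps power2_eq_square)
  also have "\<dots> = (real m)\<^sup>2 * (2 * real m * sq_dev S (\<lambda>k. y k + b k))"
    using sum_sum_sq_diff_eq_sq_dev[OF assms(1,2), of "\<lambda>k. y k + b k"]
    by (simp add: m_def flip: sum_distrib_left)
  finally have "((real m)\<^sup>2 - 1) / 6 \<le> 2 * real m * sq_dev S (\<lambda>k. y k + b k)"
    using m by (simp add: mult.assoc times_divide_eq_right[symmetric] del: times_divide_eq_right)
  then show ?thesis using m by (simp add: field_simps flip: m_def)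
qed

section \<open>Lines parallel to the vectors \<open>v\<^sup>(\<^sup>i\<^sup>)\<close>\<close>

lemma vec_v_nth: "vec_v i $ k = of_bool (k = i) - 1 / real CARD('k)" for i k :: "'k::finite"
  by (simp add: vec_v_def field_simps)

lemma hyperplane_H_add: "x \<in> hyperplane_H \<Longrightarrow> y \<in> hyperplane_H \<Longrightarrow> x + y \<in> hyperplane_H"
  by (simp add: hyperplane_H_def sum.distrib)

lemma hyperplane_H_diff: "x \<in> hyperplane_H \<Longrightarrow> y \<in> hyperplane_H \<Longrightarrow> x - y \<in> hyperplane_H"
  by (simp add: hyperplane_H_def sum_subtractf)

lemma hyperplane_H_scaleR: "x \<in> hyperplane_H \<Longrightarrow> t *\<^sub>R x \<in> hyperplane_H"
  by (simp add: hyperplane_H_def flip: sum_distrib_left)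

lemma vec_v_in_hyperplane_H: "vec_v i \<in> (hyperplane_H :: (real ^ 'k::finite) set)"
  by (simp add: hyperplane_H_def vec_v_nth sum_subtractf)

lemma lattice_A_diff: "x \<in> lattice_A \<Longrightarrow> y \<in> lattice_A \<Longrightarrow> x - y \<in> lattice_A"
  by (simp add: lattice_A_def hyperplane_H_diff)

text \<open>\<open>A\<^sub>n\<^sup>*\<close> is generated by \<open>A\<^sub>n\<close> and \<open>v\<^sup>(\<^sup>i\<^sup>)\<close>.\<close>
lemma project_along_lattice_A_dual:
  "project_along i lattice_A_dual = project_along i (lattice_A :: (real ^ 'k::finite) set)"
proof (rule set_eqI)
  fix y :: "real ^ 'k"
  have "\<exists>x'\<in>lattice_A. \<exists>t. x + s *\<^sub>R vec_v i = x' + t *\<^sub>R vec_v i" if x: "x \<in> lattice_A_dual" for x :: "real ^ 'k" and s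
  proof -
    define N where "N = real CARD('k)"
    have N: "N > 0" by (simp add: N_def)
    \<comment> \<open>This multiple turns coordinate \<open>k\<close> into
      \<open>x $ k - x $ i\<close> for \<open>k \<noteq> i\<close>, and coordinate \<open>i\<close>
      into \<open>N * x $ i\<close>, an integer because the coordinates of \<open>x\<close> sum to
      zero.\<close>
    define x' where "x' = x + (N * x $ i) *\<^sub>R vec_v i"
    have H: "x \<in> hyperplane_H" and int: "\<And>k l. x $ k - x $ l \<in> \<int>"
      using x by (auto simp: lattice_A_dual_def)
    have "N * x $ i = (\<Sum>k\<in>UNIV. x $ i - x $ k)"
      using H by (simp add: sum_subtractf hyperplane_H_def N_def)
    also have "\<dots> \<in> \<int>" using int by (intro Ints_sum) auto
    finally have Ni: "N * x $ i \<in> \<int>" .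
    have "x' $ k = x $ k - x $ i + of_bool (k = i) * (N * x $ i)" for k
      using N by (simp add: x'_def vec_v_nth algebra_simps flip: N_def)
    then have "x' $ k \<in> \<int>" for k using int[of k i] Ni by simp
    then have "x' \<in> lattice_A"
      using H by (simp add: lattice_A_def x'_def hyperplane_H_add hyperplane_H_scaleR vec_v_in_hyperplane_H)
    moreover have "x + s *\<^sub>R vec_v i = x' + (s - N * x $ i) *\<^sub>R vec_v i"
      by (simp add: x'_def algebra_simps)
    ultimately show ?thesis by blast
  qed
  moreover have "lattice_A \<subseteq> (lattice_A_dual :: (real ^ 'k) set)"
    by (auto simp: lattice_A_def lattice_A_dual_def)
  ultimately show "y \<in> project_along i lattice_A_dual \<longleftrightarrow> y \<in> project_along i lattice_A"
    unfolding project_along_def by blast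
qed

text \<open>Since \<open>w\<close> already lies in the target hyperplane, projecting commutes with
  translation by \<open>w\<close>.\<close>

lemma project_along_line_family:
  assumes "w \<in> perp_hyperplane i"
  shows "project_along i (\<Union> (line_family w i)) = (+) w ` project_along i (lattice_A :: (real ^ 'k::finite) set)"
proof (intro set_eqI iffI)
  fix y assume "y \<in> project_along i (\<Union> (line_family w i))"
  then obtain a t s where y: "y \<in> perp_hyperplane i" "a \<in> lattice_A" "y = w + a + t *\<^sub>R vec_v i + s *\<^sub>R vec_v i"
    by (auto simp: project_along_def line_family_def line_through_def)
  have "y - w = a + (t + s) *\<^sub>R vec_v i" using y(3) by (simp add: algebra_simps)
  moreover have "y - w \<in> perp_hyperplane i"
    using y(1) assms by (simp add: perp_hyperplane_def hyperplane_H_diff)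
  ultimately have "y - w \<in> project_along i lattice_A"
    using y(2) unfolding project_along_def by blast
  then show "y \<in> (+) w ` project_along i lattice_A" by (intro image_eqI[of _ _ "y - w"]) auto
next
  fix y assume "y \<in> (+) w ` project_along i lattice_A"
  then obtain a t where y: "w + (a + t *\<^sub>R vec_v i) = y" "a + t *\<^sub>R vec_v i \<in> perp_hyperplane i" "a \<in> lattice_A"
    by (auto simp: project_along_def)
  have "y \<in> perp_hyperplane i"
    using y(1,2) assms by (auto simp: perp_hyperplane_def hyperplane_H_add)
  moreover have "y \<in> line_through (w + a) (vec_v i)"
    using y(1) by (auto simp: line_through_def add.assoc)
  then have "y \<in> \<Union> (line_family w i)" using y(3) by (auto simp: line_family_def)
  moreover have "y = y + 0 *\<^sub>R vec_v i" by simp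
  ultimately show "y \<in> project_along i (\<Union> (line_family w i))"
    unfolding project_along_def by blast
qed

section \<open>Distances between lines of two families\<close>

lemma sum_UNIV_two_points:
  fixes f :: "'k::finite \<Rightarrow> 'b::comm_monoid_add"
  assumes "i \<noteq> j"
  shows "(\<Sum>k\<in>UNIV. f k) = f i + (f j + (\<Sum>k\<in>UNIV - {i, j}. f k))"
proof -
  have "UNIV = insert i (insert j (UNIV - {i, j}))" by auto
  then have "(\<Sum>k\<in>UNIV. f k) = (\<Sum>k\<in>insert i (insert j (UNIV - {i, j})). f k)" by simp
  then show ?thesis using assms by simp
qed

text \<open>Moving along the two lines changes all coordinates of \<open>p - q\<close> other than
  \<open>i\<close> and \<open>j\<close> by one common amount, which gives the lower bound. It is
  attained because the parameters can also cancel coordinates \<open>i\<close> and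
  \<open>j\<close>.\<close>

lemma setdist_line_through:
  fixes p q :: "real ^ 'k::finite"
  assumes ij: "i \<noteq> j" and card: "CARD('k) \<ge> 3" and H: "p \<in> hyperplane_H" "q \<in> hyperplane_H"
  shows "setdist (line_through p (vec_v i)) (line_through q (vec_v j))
    = sqrt (sq_dev (UNIV - {i, j}) (\<lambda>k. (p - q) $ k))"
proof -
  define N where "N = real CARD('k)"
  define x where "x = p - q"
  define S where "S = UNIV - {i, j}"
  have N: "N \<ge> 3" using card by (simp add: N_def)
  have cardS: "real (card S) = N - 2"
    using ij card by (simp add: S_def N_def card_Diff_subset of_nat_diff)
  have dist: "dist (p + t *\<^sub>R vec_v i) (q + s *\<^sub>R vec_v j) =
      sqrt ((x $ i + t - (t - s) / N)\<^sup>2 + ((x $ j - s - (t - s) / N)\<^sup>2 + (\<Sum>k\<in>S. (x $ k - (t - s) / N)\<^sup>2)))"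
    for t s
  proof -
    have "(p + t *\<^sub>R vec_v i - (q + s *\<^sub>R vec_v j)) $ k
        = x $ k + of_bool (k = i) * t - of_bool (k = j) * s - (t - s) / N" for k
      by (simp add: x_def vec_v_nth algebra_simps diff_divide_distrib flip: N_def)
    then have "dist (p + t *\<^sub>R vec_v i) (q + s *\<^sub>R vec_v j)
       = sqrt (\<Sum>k\<in>UNIV. (x $ k + of_bool (k = i) * t - of_bool (k = j) * s - (t - s) / N)\<^sup>2)"
      by (simp add: dist_norm norm_vec_def L2_set_def)
    also have "(\<Sum>k\<in>UNIV. (x $ k + of_bool (k = i) * t - of_bool (k = j) * s - (t - s) / N)\<^sup>2)
      = (x $ i + t - (t - s) / N)\<^sup>2 + ((x $ j - s - (t - s) / N)\<^sup>2
         + (\<Sum>k\<in>S. (x $ k + of_bool (k = i) * t - of_bool (k = j) * s - (t - s) / N)\<^sup>2))"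
      using ij by (subst sum_UNIV_two_points[OF ij]) (simp add: S_def)
    also have "(\<Sum>k\<in>S. (x $ k + of_bool (k = i) * t - of_bool (k = j) * s - (t - s) / N)\<^sup>2)
      = (\<Sum>k\<in>S. (x $ k - (t - s) / N)\<^sup>2)"
      by (intro sum.cong refl) (auto simp: S_def)
    finally show ?thesis .
  qed
  have "sqrt (sq_dev S (\<lambda>k. x $ k)) \<le> setdist (line_through p (vec_v i)) (line_through q (vec_v j))"
  proof (rule le_setdistI)
    fix P Q assume "P \<in> line_through p (vec_v i)" "Q \<in> line_through q (vec_v j)"
    then obtain t s where PQ: "P = p + t *\<^sub>R vec_v i" "Q = q + s *\<^sub>R vec_v j"
      by (auto simp: line_through_def)
    have "sq_dev S (\<lambda>k. x $ k) \<le> (\<Sum>k\<in>S. (x $ k - (t - s) / N)\<^sup>2)"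
      by (intro sq_dev_le_sum_sq_diff) simp
    then show "sqrt (sq_dev S (\<lambda>k. x $ k)) \<le> dist P Q"
      unfolding PQ dist by (intro real_sqrt_le_mono) (simp add: add_increasing)
  qed (auto simp: line_through_def)
  note lower = this
  define c where "c = (\<Sum>k\<in>S. x $ k) / real (card S)"
  \<comment> \<open>These parameters make coordinates \<open>i\<close> and \<open>j\<close> of the
    difference vanish if the common amount \<open>(t - s) / N\<close> is the mean \<open>c\<close>;
    the zero coordinate sum of \<open>x\<close> guarantees this.\<close>
  define t where "t = c - x $ i"
  define s where "s = x $ j - c"
  have "x \<in> hyperplane_H" using H by (simp add: x_def hyperplane_H_diff)
  then have "x $ i + (x $ j + (\<Sum>k\<in>S. x $ k)) = 0"
    unfolding hyperplane_H_def sum_UNIV_two_points[OF ij] S_def by simp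
  moreover have "(\<Sum>k\<in>S. x $ k) = (N - 2) * c" using N cardS by (simp add: c_def)
  ultimately have "t - s = N * c" by (simp add: t_def s_def algebra_simps)
  then have ts: "(t - s) / N = c" using N by simp
  have "setdist (line_through p (vec_v i)) (line_through q (vec_v j)) \<le> dist (p + t *\<^sub>R vec_v i) (q + s *\<^sub>R vec_v j)"
    by (intro setdist_le_dist) (auto simp: line_through_def)
  also have "\<dots> = sqrt (sq_dev S (\<lambda>k. x $ k))"
    unfolding dist ts by (simp add: t_def s_def sq_dev_def c_def)
  finally show ?thesis using lower unfolding S_def x_def by (rule order_antisym)
qed

lemma is_min_dist_line_family:
  fixes w w' :: "real ^ 'k::finite" and b :: "'k \<Rightarrow> int"
  assumes ij: "i \<noteq> j" and card: "CARD('k) \<ge> 3" and H: "w \<in> hyperplane_H" "w' \<in> hyperplane_H"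
    and min: "\<And>b'::'k \<Rightarrow> int. sq_dev (UNIV - {i, j}) (\<lambda>k. (w - w') $ k + b k)
               \<le> sq_dev (UNIV - {i, j}) (\<lambda>k. (w - w') $ k + b' k)"
  shows "is_min_dist (line_family w i) (line_family w' j)
           (sqrt (sq_dev (UNIV - {i, j}) (\<lambda>k. (w - w') $ k + b k)))"
proof -
  define S where "S = UNIV - {i, j}"
  define D where "D = sqrt (sq_dev S (\<lambda>k. (w - w') $ k + b k))"
  have dist: "setdist (line_through (w + a) (vec_v i)) (line_through (w' + a') (vec_v j))
      = sqrt (sq_dev S (\<lambda>k. (w - w') $ k + (a - a') $ k))"
    if "a \<in> lattice_A" "a' \<in> lattice_A" for a a'
  proof -
    have "w + a \<in> hyperplane_H" "w' + a' \<in> hyperplane_H"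
      using that H by (auto simp: lattice_A_def intro: hyperplane_H_add)
    from setdist_line_through[OF ij card this]
    have "setdist (line_through (w + a) (vec_v i)) (line_through (w' + a') (vec_v j))
      = sqrt (sq_dev S (\<lambda>k. (w + a - (w' + a')) $ k))" by (simp only: S_def)
    also have "(\<lambda>k. (w + a - (w' + a')) $ k) = (\<lambda>k. (w - w') $ k + (a - a') $ k)"
      by (rule ext) simp
    finally show ?thesis .
  qed
  \<comment> \<open>Coordinate \<open>i\<close> compensates for the sum, so any integer values on
    \<open>S\<close> extend to a vector of the lattice.\<close>
  define a :: "real ^ 'k" where
    "a = (\<chi> k. if k = i then - (\<Sum>l\<in>S. of_int (b l)) else if k = j then 0 else of_int (b k))"
  have aS: "a $ k = b k" if "k \<in> S" for k using that by (simp add: a_def S_def)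
  have "(\<Sum>k\<in>S. a $ k) = (\<Sum>l\<in>S. of_int (b l))" by (intro sum.cong refl) (simp add: aS)
  then have "a \<in> hyperplane_H"
    unfolding hyperplane_H_def using ij
    by (simp add: sum_UNIV_two_points[OF ij] flip: S_def) (simp add: a_def)
  then have a: "a \<in> lattice_A" by (auto simp: lattice_A_def a_def)
  have 0: "0 \<in> (lattice_A :: (real ^ 'k) set)" by (simp add: lattice_A_def hyperplane_H_def)
  have "setdist (line_through (w + a) (vec_v i)) (line_through (w' + 0) (vec_v j)) = D"
    unfolding dist[OF a 0] D_def by (intro arg_cong[of _ _ sqrt] sq_dev_cong) (simp add: aS)
  moreover have "D \<le> setdist (line_through (w + a) (vec_v i)) (line_through (w' + a') (vec_v j))"
    if A: "a \<in> lattice_A" "a' \<in> lattice_A" for a a'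
  proof -
    have "(a - a') $ k = \<lfloor>(a - a') $ k\<rfloor>" for k
      using lattice_A_diff[OF A] by (auto simp: lattice_A_def)
    then show ?thesis
      unfolding dist[OF A] D_def S_def using min[of "\<lambda>k. \<lfloor>(a - a') $ k\<rfloor>"] by (simp del: vector_minus_component)
  qed
  ultimately show ?thesis
    unfolding is_min_dist_def line_family_def D_def[symmetric] S_def[symmetric]
    using a 0 by blast
qed

text \<open>The minimum over integer shifts is attained; the cuts bound it from above, and equal
  spacing gives the same bound from below. With \<open>m = n - 1\<close>, the numerator
  \<open>m\<^sup>2 - 1\<close> becomes \<open>n * (n - 2)\<close>.\<close>

lemma ex_is_min_dist_line_family_le:
  fixes w w' :: "real ^ 'k::finite"
  assumes ij: "i \<noteq> j" and card: "CARD('k) = n + 1" and n: "n \<ge> 2"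
    and H: "w \<in> hyperplane_H" "w' \<in> hyperplane_H"
  shows "\<exists>d. is_min_dist (line_family w i) (line_family w' j) d \<and>
             d \<le> sqrt (real n * (real n - 2) / (12 * (real n - 1)))"
    and "unif_mod_1 (\<lambda>k. (w - w') $ k) (UNIV - {i, j}) \<Longrightarrow>
         is_min_dist (line_family w i) (line_family w' j) (sqrt (real n * (real n - 2) / (12 * (real n - 1))))"
proof -
  define S where "S = UNIV - {i, j}"
  define E where "E = real n * (real n - 2) / (12 * (real n - 1))"
  have cS: "card S = n - 1" using ij card by (simp add: S_def card_Diff_subset)
  then have "card S > 0" using n by simp
  then have S: "finite S" "S \<noteq> {}" unfolding card_gt_0_iff by auto
  have E: "((real (card S))\<^sup>2 - 1) / (12 * real (card S)) = E"
    using n by (simp add: cS E_def of_nat_diff power2_eq_square algebra_simps)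
  obtain b :: "'k \<Rightarrow> int" where b: "\<And>b'::'k \<Rightarrow> int. sq_dev S (\<lambda>k. (w - w') $ k + b k) \<le> sq_dev S (\<lambda>k. (w - w') $ k + b' k)"
    using sq_dev_int_shift_attains_min[OF S(1), of "\<lambda>k. (w - w') $ k"] by blast
  have min: "is_min_dist (line_family w i) (line_family w' j) (sqrt (sq_dev S (\<lambda>k. (w - w') $ k + b k)))"
    unfolding S_def using ij card n H b[unfolded S_def] by (intro is_min_dist_line_family) auto
  have le: "sq_dev S (\<lambda>k. (w - w') $ k + b k) \<le> E"
  proof -
    obtain b' :: "'k \<Rightarrow> int" where "sq_dev S (\<lambda>k. (w - w') $ k + b' k) \<le> E"
      using ex_int_shift_sq_dev_le[OF S, of "\<lambda>k. (w - w') $ k"] unfolding E by blast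
    with b[of b'] show ?thesis by (rule order_trans)
  qed
  show "\<exists>d. is_min_dist (line_family w i) (line_family w' j) d \<and> d \<le> sqrt E"
    using min le by (intro exI conjI) (assumption, simp only: real_sqrt_le_iff)
  assume "unif_mod_1 (\<lambda>k. (w - w') $ k) (UNIV - {i, j})"
  then have "E \<le> sq_dev S (\<lambda>k. (w - w') $ k + b k)"
    using sq_dev_int_shift_ge[OF S] unfolding E by (simp add: S_def)
  with le have "sq_dev S (\<lambda>k. (w - w') $ k + b k) = E" by (rule order_antisym)
  with min show "is_min_dist (line_family w i) (line_family w' j) (sqrt E)" by (simp only:)
qed

section \<open>The vectors from discrete logarithms\<close>

text \<open>Multiplication by \<open>x\<close> permutes the nonzero elements, so it preserves their
  product.\<close>

lemma power_card_diff_1_eq_1: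
  fixes x :: "'f::{field,finite}"
  assumes "x \<noteq> 0"
  shows "x ^ (CARD('f) - 1) = 1"
proof -
  have "x ^ (CARD('f) - 1) * \<Prod>(UNIV - {0 :: 'f}) = (\<Prod>y\<in>UNIV - {0}. x * y)"
    by (simp add: prod.distrib)
  also have "\<dots> = \<Prod>(UNIV - {0})"
    by (rule prod.reindex_bij_witness[of _ "\<lambda>y. y / x" "\<lambda>y. x * y"]) (use assms in auto)
  finally show ?thesis by simp
qed

lemma unif_mod_1I:
  assumes "finite K" "inj_on \<sigma> K" "\<And>k. k \<in> K \<Longrightarrow> \<sigma> k < card K"
    and "\<And>k. k \<in> K \<Longrightarrow> [y k = c + real (\<sigma> k) / real (card K)] (rmod 1)"
  shows "unif_mod_1 y K"
proof -
  have "\<sigma> ` K = {0..<card K}"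
    using assms(2,3) by (intro card_subset_eq) (auto simp: card_image)
  then show ?thesis
    unfolding unif_mod_1_def using assms(2,4) by (auto simp: bij_betw_def)
qed

text \<open>The index \<open>z\<close> stands for n + 1; the other indices label the field elements
  through \<open>a\<close>.\<close>

locale difference_log =
  fixes n :: nat and z :: "'k::finite" and a :: "'k \<Rightarrow> 'f::{field,finite}"
    and \<alpha> :: 'f and M :: "'k \<Rightarrow> 'k \<Rightarrow> nat"
  assumes n: "n \<ge> 2" and card_field: "CARD('f) = n" and card_index: "CARD('k) = n + 1"
    and inj_a: "inj_on a (UNIV - {z})"
    and M_le: "\<And>i j. i \<noteq> z \<Longrightarrow> j \<noteq> z \<Longrightarrow> i \<noteq> j \<Longrightarrow> M i j \<le> n - 2"
    and power_M: "\<And>i j. i \<noteq> z \<Longrightarrow> j \<noteq> z \<Longrightarrow> i \<noteq> j \<Longrightarrow> \<alpha> ^ M i j = a i - a j"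
    and \<alpha>_nonzero: "\<alpha> \<noteq> 0"
begin

definition u :: "'k \<Rightarrow> real ^ 'k" where
  "u i = (\<chi> j. if i = j \<or> i = z \<or> j = z then 0
                else (real (M i j) + 1/2) / (real n - 1) - 1/2)"

lemma M_less: "i \<noteq> z \<Longrightarrow> j \<noteq> z \<Longrightarrow> i \<noteq> j \<Longrightarrow> M i j < n - 1"
  using M_le[of i j] n by linarith

lemma card_minus_two: "i \<noteq> j \<Longrightarrow> card (UNIV - {i, j}) = n - 1" for i j :: 'k
  using card_index by (simp add: card_Diff_subset)

lemma inj_on_M: "i \<noteq> z \<Longrightarrow> inj_on (M i) (UNIV - {i, z})"
proof (rule inj_onI)
  fix k l assume "i \<noteq> z" and kl: "k \<in> UNIV - {i, z}" "l \<in> UNIV - {i, z}" "M i k = M i l"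
  then have "a i - a k = a i - a l" using power_M[of i k] power_M[of i l] by auto
  then show "k = l" using inj_onD[OF inj_a, of k l] kl by simp
qed

lemma image_M:
  assumes "i \<noteq> z" shows "M i ` (UNIV - {i, z}) = {..<n - 1}"
proof (rule card_subset_eq)
  show "card (M i ` (UNIV - {i, z})) = card {..<n - 1}"
    using card_image[OF inj_on_M[OF assms]] card_minus_two[OF assms] by simp
qed (use assms M_less in auto)

text \<open>For \<open>i \<noteq> z\<close>, the coordinates other than \<open>i\<close> and
  \<open>z\<close> are the midpoints of the n - 1 equal parts of [-1/2, 1/2], each occurring once,
  and so cancel.\<close>

lemma u_in_hyperplane_H: "u i \<in> hyperplane_H"
proof (cases "i = z")
  case False
  have "(\<Sum>k\<in>UNIV - {i, z}. u i $ k) = (\<Sum>k\<in>UNIV - {i, z}. (real (M i k) + 1/2) / (real n - 1) - 1/2)"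
    using False by (intro sum.cong refl) (auto simp: u_def)
  also have "\<dots> = (\<Sum>k<n - 1. (real k + 1/2) / (real n - 1) - 1/2)"
    unfolding image_M[OF False, symmetric] by (subst sum.reindex[OF inj_on_M[OF False]]) simp
  also have "\<dots> = (\<Sum>k<n - 1. real k + 1/2) / (real n - 1) - real (n - 1) / 2"
    by (simp add: sum_subtractf sum_divide_distrib)
  also have "(\<Sum>k<m. real k + 1/2) = (real m)\<^sup>2 / 2" for m
    by (induction m) (simp_all add: power2_eq_square field_simps)
  finally have "(\<Sum>k\<in>UNIV - {i, z}. u i $ k) = 0"
    using n by (simp add: of_nat_diff power2_eq_square field_simps)
  then show ?thesis
    unfolding hyperplane_H_def using sum_UNIV_two_points[OF False, of "($) (u i)"] False
    by (simp add: u_def)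
qed (simp add: u_def hyperplane_H_def)

lemma power_mod_order: "\<alpha> ^ (q mod (n - 1)) = \<alpha> ^ q"
proof -
  have "\<alpha> ^ q = \<alpha> ^ ((n - 1) * (q div (n - 1)) + q mod (n - 1))" by simp
  also have "\<dots> = \<alpha> ^ (q mod (n - 1))"
    using power_card_diff_1_eq_1[OF \<alpha>_nonzero]
    unfolding power_add power_mult card_field by simp
  finally show ?thesis by simp
qed

lemma unif_mod_1_u_diff:
  assumes ij: "i \<noteq> j"
  shows "unif_mod_1 (\<lambda>k. (u i - u j) $ k) (UNIV - {i, j})"
proof -
  define S where "S = UNIV - {i, j}"
  have cS: "card S = n - 1" using card_minus_two[OF ij] by (simp add: S_def)
  have m: "real (n - 1) = real n - 1" "real n - 1 > 0" using n by (auto simp: of_nat_diff)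
  consider "i = z" | "j = z" | "i \<noteq> z" "j \<noteq> z" by blast
  then have "unif_mod_1 (\<lambda>k. (u i - u j) $ k) S"
  proof cases
    case 1
    then have jz: "j \<noteq> z" and S: "S = UNIV - {j, z}" using ij by (auto simp: S_def)
    show ?thesis
    \<comment> \<open>With \<open>u i = 0\<close> the coordinates are the negated row
      \<open>j\<close>, so the order is reversed; \<open>c\<close> is the smallest value, reached
      when \<open>M j k = n - 2\<close>.\<close>
    proof (rule unif_mod_1I[where \<sigma> = "\<lambda>k. n - 2 - M j k" and c = "1/2 - 1/2 / (real n - 1) - (real n - 2) / (real n - 1)"])
      show "inj_on (\<lambda>k. n - 2 - M j k) S"
      proof (rule inj_onI)
        fix k l assume kl: "k \<in> S" "l \<in> S" "n - 2 - M j k = n - 2 - M j l"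
        then have "M j k = M j l"
          using M_le[of j k] M_le[of j l] jz by (auto simp: S)
        then show "k = l" using inj_onD[OF inj_on_M[OF jz]] kl by (auto simp: S)
      qed
    next
      fix k assume k: "k \<in> S"
      have "(u i - u j) $ k = - ((real (M j k) + 1/2) / (real n - 1) - 1/2)"
        using k jz 1 by (auto simp: u_def S)
      also have "\<dots> = 1/2 - 1/2 / (real n - 1) - (real n - 2) / (real n - 1) + real (n - 2 - M j k) / real (card S)"
      proof -
        have "M j k + 2 \<le> n" using M_le[of j k] k jz n by (auto simp: S)
        then have "real (n - 2 - M j k) = real n - 2 - real (M j k)" by (simp add: of_nat_diff)
        then show ?thesis
          unfolding cS m(1) by (simp add: add_divide_distrib diff_divide_distrib)
      qed
      finally show "[(u i - u j) $ k = 1/2 - 1/2 / (real n - 1) - (real n - 2) / (real n - 1) + real (n - 2 - M j k) / real (card S)] (rmod 1)"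
        by simp
    qed (use n in \<open>auto simp: cS\<close>)
  next
    case 2
    then have iz: "i \<noteq> z" and S: "S = UNIV - {i, z}" using ij by (auto simp: S_def)
    show ?thesis
    proof (rule unif_mod_1I[where \<sigma> = "M i" and c = "1/2 / (real n - 1) - 1/2"])
      fix k assume k: "k \<in> S"
      have "(u i - u j) $ k = 1/2 / (real n - 1) - 1/2 + real (M i k) / real (card S)"
        using k iz 2 unfolding cS m(1) by (auto simp: u_def S add_divide_distrib)
      then show "[(u i - u j) $ k = 1/2 / (real n - 1) - 1/2 + real (M i k) / real (card S)] (rmod 1)"
        by simp
    next
      show "M i k < card S" if "k \<in> S" for k
        using that iz M_less[of i k] unfolding cS by (auto simp: S)
    qed (use inj_on_M[OF iz] in \<open>auto simp: S\<close>)
  next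
    case 3
    \<comment> \<open>The logarithm of \<open>(a i - a k) / (a j - a k)\<close>; adding
      \<open>n - 1\<close> first avoids truncated subtraction. Both vectors vanish at
      \<open>z\<close>, hence the value 0 there.\<close>
    define \<sigma> where "\<sigma> k = (if k = z then 0 else (M i k + (n - 1 - M j k)) mod (n - 1))" for k
    have power_\<sigma>: "\<alpha> ^ \<sigma> k * (a j - a k) = a i - a k" if "k \<in> S" "k \<noteq> z" for k
    proof -
      have k: "k \<noteq> i" "k \<noteq> j" using that by (auto simp: S_def)
      have "\<alpha> ^ \<sigma> k * (a j - a k) = \<alpha> ^ (M i k + (n - 1 - M j k)) * \<alpha> ^ M j k"
        using that k 3 power_M[of j k] by (simp add: \<sigma>_def power_mod_order del: One_nat_def)
      also have "\<dots> = \<alpha> ^ (M i k + (n - 1))"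
        using M_less[of j k] that k 3 by (simp flip: power_add)
      also have "\<dots> = a i - a k"
        using power_card_diff_1_eq_1[OF \<alpha>_nonzero] power_M[of i k] that k 3
        by (simp add: power_add card_field)
      finally show ?thesis .
    qed
    have aij: "a i \<noteq> a j" using inj_onD[OF inj_a, of i j] 3 ij by auto
    \<comment> \<open>A quotient equal to 1 would force \<open>a i = a j\<close>; so the residue 0
      is left for \<open>z\<close> alone.\<close>
    have ne: "\<alpha> ^ \<sigma> k \<noteq> 1" if "k \<in> S" "k \<noteq> z" for k
      using power_\<sigma>[OF that] aij by auto
    have inj': "k = l" if "k \<in> S" "l \<in> S" "k \<noteq> z" "l \<noteq> z" "\<sigma> k = \<sigma> l" for k l
    proof (rule ccontr)
      assume "k \<noteq> l"
      then have "a k \<noteq> a l" using inj_onD[OF inj_a, of k l] that by auto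
      moreover have "\<alpha> ^ \<sigma> k * (a l - a k) = a l - a k"
      proof -
        \<comment> \<open>Subtracting the equations for \<open>k\<close> and \<open>l\<close> with a
          common quotient eliminates \<open>a i\<close> and \<open>a j\<close> and makes that
          quotient 1.\<close>
        have "\<alpha> ^ \<sigma> k * (a l - a k) = \<alpha> ^ \<sigma> k * (a j - a k) - \<alpha> ^ \<sigma> l * (a j - a l)"
          using that by (simp add: algebra_simps)
        also have "\<dots> = a l - a k" using power_\<sigma>[of k] power_\<sigma>[of l] that by simp
        finally show ?thesis .
      qed
      ultimately show False using ne[of k] that by auto
    qed
    show ?thesis
    proof (rule unif_mod_1I[where \<sigma> = \<sigma> and c = 0])
      show "inj_on \<sigma> S"
      proof (rule inj_onI)
        fix k l assume kl: "k \<in> S" "l \<in> S" "\<sigma> k = \<sigma> l"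
        have "\<sigma> z = 0" by (simp add: \<sigma>_def)
        then show "k = l" using kl inj'[of k l] ne[of k] ne[of l] by (metis power_0)
      qed
    next
      fix k assume k: "k \<in> S"
      show "[(u i - u j) $ k = 0 + real (\<sigma> k) / real (card S)] (rmod 1)"
      proof (cases "k = z")
        case True then show ?thesis by (simp add: u_def \<sigma>_def)
      next
        case False
        define q where "q = M i k + (n - 1 - M j k)"
        have kij: "k \<noteq> i" "k \<noteq> j" using k by (auto simp: S_def)
        have \<sigma>: "\<sigma> k = q mod (n - 1)" using False by (simp add: \<sigma>_def q_def)
        have "real q = real (M i k) - real (M j k) + (real n - 1)"
          using M_less[of j k] False kij 3 n by (simp add: q_def of_nat_diff)
        moreover have "real q = (real n - 1) * real (q div (n - 1)) + real (\<sigma> k)"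
          unfolding \<sigma> m(1)[symmetric] of_nat_mult[symmetric] of_nat_add[symmetric] by simp
        moreover have "(u i - u j) $ k = (real (M i k) - real (M j k)) / (real n - 1)"
          using False kij 3 by (simp add: u_def add_divide_distrib diff_divide_distrib)
        \<comment> \<open>The two sides differ by the extra \<open>n - 1\<close> in \<open>q\<close>
          and by the multiples removed in the reduction, which are integers after division by
          \<open>n - 1\<close>.\<close>
        ultimately have "real (\<sigma> k) / (real n - 1) = (u i - u j) $ k + of_int (1 - int (q div (n - 1))) * 1"
          using m(2) by (simp add: field_simps)
        then show ?thesis unfolding rcong_altdef cS m(1) by (metis add_0)
      qed
    qed (use n in \<open>auto simp: cS \<sigma>_def\<close>)
  qed
  then show ?thesis by (simp add: S_def)
qed

end

theorem mainTheorem1: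
  fixes n :: nat
    and z :: "'k::finite"
    and a :: "'k \<Rightarrow> 'f::{field,finite}"
    and \<alpha> :: 'f
    and M :: "'k \<Rightarrow> 'k \<Rightarrow> nat"
    and u :: "'k \<Rightarrow> real ^ 'k"
  assumes "n \<ge> 2" and "primepow n"
    and "CARD('f) = n" and "CARD('k) = n + 1"
    and "bij_betw a (UNIV - {z}) UNIV"
    and "primitive_element \<alpha>"
    and "\<And>i j. i \<noteq> z \<Longrightarrow> j \<noteq> z \<Longrightarrow> i \<noteq> j \<Longrightarrow>
           M i j \<in> {0..n-2} \<and> \<alpha> ^ M i j = a i - a j"
    and "\<And>i j. u i $ j = (if i = j \<or> i = z \<or> j = z then 0
                        else (real (M i j) + 1/2) / (real n - 1) - 1/2)"
  shows "(\<forall>i. u i \<in> hyperplane_H \<and> u i $ i = 0) \<and>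
    (\<forall>i. is_translate (project_along i (\<Union> (line_family (u i) i)))
                      (project_along i lattice_A_dual)) \<and>
    (\<forall>i j. i \<noteq> j \<longrightarrow>
       unif_mod_1 (\<lambda>k. (u i - u j) $ k) (UNIV - {i, j}) \<and>
       is_min_dist (line_family (u i) i) (line_family (u j) j)
         (sqrt (real n * (real n - 2) / (12 * (real n - 1)))) \<and>
       (\<forall>w\<in>hyperplane_H. \<forall>w'\<in>hyperplane_H. w $ i = 0 \<longrightarrow> w' $ j = 0 \<longrightarrow>
          (\<exists>d. is_min_dist (line_family w i) (line_family w' j) d \<and>
               d \<le> sqrt (real n * (real n - 2) / (12 * (real n - 1))))))"
proof -
  have "\<alpha> ^ 1 \<in> - {0}"
    using assms(6) unfolding primitive_element_def by blast
  then interpret D: difference_log n z a \<alpha> M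
    using assms(1,3,4,5,7) by unfold_locales (auto simp: bij_betw_def)
  have u: "u = D.u" by (rule ext) (simp add: vec_eq_iff D.u_def assms(8))
  have H: "u i \<in> hyperplane_H" and 0: "u i $ i = 0" for i
    by (simp_all add: u D.u_in_hyperplane_H) (simp add: D.u_def)
  have tr: "is_translate (project_along i (\<Union> (line_family (u i) i))) (project_along i lattice_A_dual)" for i
    using project_along_line_family[of "u i" i] H 0
    by (auto simp: is_translate_def project_along_lattice_A_dual perp_hyperplane_def)
  have unif: "unif_mod_1 (\<lambda>k. (u i - u j) $ k) (UNIV - {i, j})" if "i \<noteq> j" for i j
    unfolding u by (rule D.unif_mod_1_u_diff[OF that])
  show ?thesis
  proof (intro conjI allI impI ballI)
    fix i j :: 'k assume ij: "i \<noteq> j"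
    show "unif_mod_1 (\<lambda>k. (u i - u j) $ k) (UNIV - {i, j})" by (rule unif[OF ij])
    show "is_min_dist (line_family (u i) i) (line_family (u j) j)
        (sqrt (real n * (real n - 2) / (12 * (real n - 1))))"
      by (rule ex_is_min_dist_line_family_le(2)[OF ij assms(4,1) H H unif[OF ij]])
    show "\<exists>d. is_min_dist (line_family w i) (line_family w' j) d \<and>
        d \<le> sqrt (real n * (real n - 2) / (12 * (real n - 1)))"
      if "w \<in> hyperplane_H" "w' \<in> hyperplane_H" for w w'
      by (rule ex_is_min_dist_line_family_le(1)[OF ij assms(4,1) that])
  qed (rule H 0 tr)+
qed

end
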